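(* Let $n\ge1$, $\lambda=(\lambda_1,\dots,\lambda_n)\in\mathbb R^n$, and let $g$ be any one of the four functions $\sin^-_\lambda,\ \sin^+_\lambda,\ \cos^-_\lambda,\ \cos^+_\lambda$ on $\mathbb R^n$. Then for every $k=1,2,\dots,n$ and all $x\in\mathbb R^n$, $$\sigma_k\Big(\frac{\partial^2}{\partial x_1^2},\frac{\partial^2}{\partial x_2^2},\dots,\frac{\partial^2}{\partial x_n^2}\Big)g(x)=(-4\pi^2)^k\,\sigma_k(\lambda_1^2,\lambda_2^2,\dots,\lambda_n^2)\,g(x).$$ In particular (the case $k=1$), $\Delta g=-4\pi^2\langle\lambda,\lambda\rangle\, g$, where $\Delta=\sum_{i=1}^n\partial^2/\partial x_i^2$ and $\langle\lambda,\lambda\rangle=\sum_{i=1}^n\lambda_i^2$.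
   Context: $\sin^-_\lambda(x)=\det(\sin 2\pi\lambda_ix_j)_{i,j=1}^n$ and $\cos^-_\lambda(x)=\det(\cos2\pi\lambda_ix_j)_{i,j=1}^n$; $\sin^+_\lambda(x)=\sum_{w\in S_n}\prod_{j=1}^n\sin(2\pi\lambda_{w(j)}x_j)$ and $\cos^+_\lambda(x)=\sum_{w\in S_n}\prod_{j=1}^n\cos(2\pi\lambda_{w(j)}x_j)$, where $S_n$ is the symmetric group. $\sigma_k(y_1,\dots,y_n)=\sum_{1\le i_1<i_2<\cdots<i_k\le n}y_{i_1}y_{i_2}\cdots y_{i_k}$ is the $k$-th elementary symmetric polynomial. *)

theory Defs
  imports "HOL-Analysis.Analysis"
begin

text \<open>
  The coordinates \<open>1, \<dots>, n\<close> are the elements of a finite linearly ordered type \<open>'n\<close>,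
  so that \<open>n = CARD('n)\<close> and index sequences \<open>i\<^sub>1 < \<dots> < i\<^sub>k\<close> make sense.
\<close>

definition sin_minus :: "real ^ 'n::finite \<Rightarrow> real ^ 'n \<Rightarrow> real" where
  "sin_minus l x = det (\<chi> i j. sin (2 * pi * l $ i * x $ j))"

definition cos_minus :: "real ^ 'n::finite \<Rightarrow> real ^ 'n \<Rightarrow> real" where
  "cos_minus l x = det (\<chi> i j. cos (2 * pi * l $ i * x $ j))"

definition sin_plus :: "real ^ 'n::finite \<Rightarrow> real ^ 'n \<Rightarrow> real" where
  "sin_plus l x = (\<Sum>w | w permutes UNIV. \<Prod>j\<in>UNIV. sin (2 * pi * l $ w j * x $ j))"

definition cos_plus :: "real ^ 'n::finite \<Rightarrow> real ^ 'n \<Rightarrow> real" where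
  "cos_plus l x = (\<Sum>w | w permutes UNIV. \<Prod>j\<in>UNIV. cos (2 * pi * l $ w j * x $ j))"

definition partial_deriv :: "'n::finite \<Rightarrow> (real ^ 'n \<Rightarrow> real) \<Rightarrow> real ^ 'n \<Rightarrow> real" where
  "partial_deriv i f x = deriv (\<lambda>t. f (x + t *\<^sub>R axis i 1)) 0"

definition partial_deriv2 :: "'n::finite \<Rightarrow> (real ^ 'n \<Rightarrow> real) \<Rightarrow> real ^ 'n \<Rightarrow> real" where
  "partial_deriv2 i f = partial_deriv i (partial_deriv i f)"

definition increasing_seqs :: "nat \<Rightarrow> 'n::{finite,linorder} list set" where
  "increasing_seqs k = {xs. length xs = k \<and> sorted_wrt (<) xs}"

lemma finite_increasing_seqs: "finite (increasing_seqs k :: 'n::{finite,linorder} list set)"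
  by (rule finite_subset[OF _ finite_lists_length_eq[of "UNIV :: 'n set" k]])
     (auto simp: increasing_seqs_def)

definition elem_sym :: "nat \<Rightarrow> ('n::{finite,linorder} \<Rightarrow> real) \<Rightarrow> real" where
  "elem_sym k y = (\<Sum>xs\<in>increasing_seqs k. \<Prod>i\<leftarrow>xs. y i)"

text \<open>
  The same polynomial with operators substituted for the variables: the product
  \<open>D i\<^sub>1 \<cdots> D i\<^sub>k\<close> is composition and the sum is pointwise.
\<close>

definition elem_sym_op ::
  "nat \<Rightarrow> ('n::{finite,linorder} \<Rightarrow> (real ^ 'n::{finite,linorder} \<Rightarrow> real) \<Rightarrow> real ^ 'n::{finite,linorder} \<Rightarrow> real) \<Rightarrow>
    (real ^ 'n::{finite,linorder} \<Rightarrow> real) \<Rightarrow> real ^ 'n::{finite,linorder} \<Rightarrow> real" where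
  "elem_sym_op k D f x = (\<Sum>xs\<in>increasing_seqs k. foldr (\<circ>) (map D xs) id f x)"

definition laplacian :: "(real ^ 'n::finite \<Rightarrow> real) \<Rightarrow> real ^ 'n \<Rightarrow> real" where
  "laplacian f x = (\<Sum>i\<in>UNIV. partial_deriv2 i f x)"

end

theory Submission
  imports Defs
begin

text \<open>
  Each of the four functions is a linear combination over permutations \<open>w\<close> of products
  \<open>\<Prod>\<^sub>j h (2 \<pi> \<lambda>\<^bsub>w j\<^esub> x\<^sub>j)\<close> with \<open>h'' = - h\<close>. Such a product is a common eigenfunction of the
  operators \<open>\<partial>\<^sup>2/\<partial>x\<^sub>i\<^sup>2\<close>, with eigenvalues \<open>- 4 \<pi>\<^sup>2 \<lambda>\<^bsub>w i\<^esub>\<^sup>2\<close>. Since \<open>\<sigma>\<^sub>k\<close> is symmetric, the resulting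
  eigenvalue of \<open>\<sigma>\<^sub>k\<close> of these operators does not depend on \<open>w\<close>.
\<close>

text \<open>Sorting matches the \<open>k\<close>-element subsets with the strictly increasing lists
  of length \<open>k\<close>. Subsets are easier to reindex, since a permutation acts on them by
  images.\<close>

lemma elem_sym_conv_subsets:
  "elem_sym k y = (\<Sum>S | card S = k. \<Prod>i\<in>S. y i)"
  for y :: "'n::{finite,linorder} \<Rightarrow> real"
  unfolding elem_sym_def increasing_seqs_def
  by (rule sum.reindex_bij_witness[of _ sorted_list_of_set set])
     (auto simp: strict_sorted_iff prod.distinct_set_conv_list distinct_card
        sorted_list_of_set.idem_if_sorted_distinct)

lemma elem_sym_permute:
  fixes y :: "'n::{finite,linorder} \<Rightarrow> real"
  assumes "w permutes UNIV"
  shows "elem_sym k (\<lambda>i. y (w i)) = elem_sym k y"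
  unfolding elem_sym_conv_subsets
proof (rule sum.reindex_bij_witness[of _ "\<lambda>S. inv w ` S" "\<lambda>S. w ` S"])
  have bij: "bij w"
    using assms by (rule permutes_bij)
  note inj = bij_is_inj[OF bij] bij_is_inj[OF bij_imp_bij_inv[OF bij]]
  fix S :: "'n set"
  show "inv w ` w ` S = S" "w ` inv w ` S = S"
    using bij by (simp_all add: image_inv_f_f image_f_inv_f bij_is_inj bij_is_surj)
  show "w ` S \<in> {S. card S = k}" if "S \<in> {S. card S = k}"
    using that inj by (simp add: card_image inj_on_subset)
  show "inv w ` S \<in> {S. card S = k}" if "S \<in> {S. card S = k}"
    using that inj by (simp add: card_image inj_on_subset)
  show "(\<Prod>i\<in>w ` S. y i) = (\<Prod>i\<in>S. y (w i))"
    using inj by (simp add: prod.reindex inj_on_subset)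
qed

lemma elem_sym_scale: "elem_sym k (\<lambda>i. a * y i) = a ^ k * elem_sym k y"
  unfolding elem_sym_conv_subsets by (auto simp: prod.distrib sum_distrib_left intro!: sum.cong)

text \<open>Only the factor with index \<open>i\<close> depends on the \<open>i\<close>-th
  coordinate. The result is again a weighted sum of products of one-variable functions, so the lemma
  can be applied to its own output.\<close>

lemma partial_deriv_sum_prod:
  fixes F F' :: "'w \<Rightarrow> 'n::finite \<Rightarrow> real \<Rightarrow> real"
  assumes "\<And>w t. w \<in> W \<Longrightarrow> (F w i has_real_derivative F' w i t) (at t)"
  shows "partial_deriv i (\<lambda>x. \<Sum>w\<in>W. c w * (\<Prod>j\<in>UNIV. F w j (x $ j))) =
    (\<lambda>x. \<Sum>w\<in>W. c w * (\<Prod>j\<in>UNIV. (if j = i then F' w j else F w j) (x $ j)))"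
proof
  fix x :: "real ^ 'n"
  have split: "(\<Prod>j\<in>UNIV. f j) = f i * (\<Prod>j\<in>UNIV - {i}. f j)" for f :: "'n \<Rightarrow> real"
    by (simp add: prod.remove)
  have "((\<lambda>t. \<Sum>w\<in>W. c w * (F w i (x $ i + t) * (\<Prod>j\<in>UNIV - {i}. F w j (x $ j))))
      has_real_derivative
      (\<Sum>w\<in>W. c w * (F' w i (x $ i) * (\<Prod>j\<in>UNIV - {i}. F w j (x $ j))))) (at 0)"
    by (intro DERIV_sum DERIV_cmult DERIV_cmult_right)
       \<comment> \<open>\<open>DERIV_shift\<close> turns the derivative of \<open>F w i\<close> at
         \<open>x $ i\<close> into one of the translate at 0.\<close>
       (use assms in \<open>simp add: DERIV_shift[of _ _ 0, symmetric] add.commute\<close>)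
  moreover have "(\<Prod>j\<in>UNIV. F w j ((x + t *\<^sub>R axis i 1) $ j)) =
      F w i (x $ i + t) * (\<Prod>j\<in>UNIV - {i}. F w j (x $ j))" for w t
    unfolding split by (auto simp: axis_def intro!: prod.cong)
  moreover have "(\<Prod>j\<in>UNIV. (if j = i then F' w j else F w j) (x $ j)) =
      F' w i (x $ i) * (\<Prod>j\<in>UNIV - {i}. F w j (x $ j))" for w
    unfolding split by (auto intro!: prod.cong)
  ultimately show "partial_deriv i (\<lambda>x. \<Sum>w\<in>W. c w * (\<Prod>j\<in>UNIV. F w j (x $ j))) x =
      (\<Sum>w\<in>W. c w * (\<Prod>j\<in>UNIV. (if j = i then F' w j else F w j) (x $ j)))"
    by (simp add: partial_deriv_def DERIV_imp_deriv)
qed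

lemma partial_deriv2_sum_prod:
  fixes F F' :: "'w \<Rightarrow> 'n::finite \<Rightarrow> real \<Rightarrow> real"
  assumes F: "\<And>w t. w \<in> W \<Longrightarrow> (F w i has_real_derivative F' w i t) (at t)"
    and F': "\<And>w t. w \<in> W \<Longrightarrow> (F' w i has_real_derivative m w i * F w i t) (at t)"
  shows "partial_deriv2 i (\<lambda>x. \<Sum>w\<in>W. c w * (\<Prod>j\<in>UNIV. F w j (x $ j))) =
    (\<lambda>x. \<Sum>w\<in>W. c w * m w i * (\<Prod>j\<in>UNIV. F w j (x $ j)))"
proof -
  \<comment> \<open>\<open>?F1\<close> is the family after one differentiation; its
    \<open>i\<close>-th factor \<open>F' w i\<close> has derivative \<open>?F2 w i\<close>.\<close>
  let ?F1 = "\<lambda>w j. if j = i then F' w j else F w j"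
  let ?F2 = "\<lambda>w j t. m w j * F w j t"
  have prod_eq: "(\<Prod>j\<in>UNIV. (if j = i then ?F2 w j else ?F1 w j) (x $ j)) =
      m w i * (\<Prod>j\<in>UNIV. F w j (x $ j))" for w x
    by (auto simp: prod.remove[of UNIV i] intro!: prod.cong)
  have "partial_deriv2 i (\<lambda>x. \<Sum>w\<in>W. c w * (\<Prod>j\<in>UNIV. F w j (x $ j))) =
      partial_deriv i (\<lambda>x. \<Sum>w\<in>W. c w * (\<Prod>j\<in>UNIV. ?F1 w j (x $ j)))"
    unfolding partial_deriv2_def
    by (subst partial_deriv_sum_prod[where F = F and F' = F']) (auto intro: F)
  also have "\<dots> = (\<lambda>x. \<Sum>w\<in>W. c w *
      (\<Prod>j\<in>UNIV. (if j = i then ?F2 w j else ?F1 w j) (x $ j)))"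
    by (rule partial_deriv_sum_prod[where F = ?F1 and F' = ?F2]) (simp add: F')
  finally show ?thesis
    by (simp only: prod_eq mult.assoc)
qed

text \<open>Each operator preserves the products and multiplies the coefficient of \<open>w\<close>
  by \<open>m w i\<close>, so the induction step reuses the previous lemma with the coefficient
  accumulated so far.\<close>

lemma foldr_partial_deriv2_sum_prod:
  fixes F F' :: "'w \<Rightarrow> 'n::finite \<Rightarrow> real \<Rightarrow> real"
  assumes F: "\<And>w i t. w \<in> W \<Longrightarrow> (F w i has_real_derivative F' w i t) (at t)"
    and F': "\<And>w i t. w \<in> W \<Longrightarrow> (F' w i has_real_derivative m w i * F w i t) (at t)"
  shows "foldr (\<circ>) (map partial_deriv2 xs) id (\<lambda>x. \<Sum>w\<in>W. c w * (\<Prod>j\<in>UNIV. F w j (x $ j))) =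
    (\<lambda>x. \<Sum>w\<in>W. c w * (\<Prod>i\<leftarrow>xs. m w i) * (\<Prod>j\<in>UNIV. F w j (x $ j)))"
proof (induction xs)
  case (Cons i xs)
  then show ?case
    by (simp only: list.map foldr_Cons o_apply
        partial_deriv2_sum_prod[where F = F and F' = F' and m = m, OF F F'])
       (simp add: mult_ac)
qed simp

lemma elem_sym_op_trig_sum:
  fixes l :: "real ^ 'n::{finite,linorder}" and h h' :: "real \<Rightarrow> real"
  assumes h: "\<And>t. (h has_real_derivative h' t) (at t)"
    and h': "\<And>t. (h' has_real_derivative - h t) (at t)"
    and g: "\<And>x. g x = (\<Sum>w | w permutes UNIV. c w * (\<Prod>j\<in>UNIV. h (2 * pi * l $ w j * x $ j)))"
  shows "elem_sym_op k partial_deriv2 g x =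
      (- 4 * pi\<^sup>2) ^ k * elem_sym k (\<lambda>i. (l $ i)\<^sup>2) * g x" (is ?thesis1)
    and "laplacian g x = - 4 * pi\<^sup>2 * (l \<bullet> l) * g x" (is ?thesis2)
proof -
  define W where "W = {w :: 'n \<Rightarrow> 'n. w permutes UNIV}"
  define F where "F w j t = h (2 * pi * l $ w j * t)" for w :: "'n \<Rightarrow> 'n" and j t
  define F' where "F' w j t = 2 * pi * l $ w j * h' (2 * pi * l $ w j * t)" for w :: "'n \<Rightarrow> 'n" and j t
  \<comment> \<open>The chain rule, applied twice, yields the square of
    \<open>2 * pi * l $ w j\<close>; the sign comes from h'' = -h.\<close>
  define m where "m w j = (- 4 * pi\<^sup>2) * (l $ w j)\<^sup>2" for w :: "'n \<Rightarrow> 'n" and j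
  have F: "(F w i has_real_derivative F' w i t) (at t)" for w i t
    using DERIV_chain2[OF h DERIV_cmult_Id[of "2 * pi * l $ w i"], of t]
    by (simp add: F_def[abs_def] F'_def mult_ac)
  have F': "(F' w i has_real_derivative m w i * F w i t) (at t)" for w i t
    using DERIV_cmult[OF DERIV_chain2[OF h' DERIV_cmult_Id[of "2 * pi * l $ w i"], of t],
        of "2 * pi * l $ w i"]
    by (simp add: F_def F'_def[abs_def] m_def power2_eq_square mult_ac)
  have g_eq: "g = (\<lambda>x. \<Sum>w\<in>W. c w * (\<Prod>j\<in>UNIV. F w j (x $ j)))"
    by (simp add: g W_def F_def fun_eq_iff)
  have "elem_sym_op k partial_deriv2 g x =
      (\<Sum>w\<in>W. c w * elem_sym k (m w) * (\<Prod>j\<in>UNIV. F w j (x $ j)))"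
    unfolding elem_sym_op_def elem_sym_def g_eq foldr_partial_deriv2_sum_prod[OF F F']
    \<comment> \<open>With the sum over \<open>w\<close> outermost, the inner sum over increasing
      lists is \<open>elem_sym k (m w)\<close>.\<close>
    by (subst sum.swap) (simp add: sum_distrib_left sum_distrib_right)
  also have "\<dots> = (\<Sum>w\<in>W. c w * ((- 4 * pi\<^sup>2) ^ k * elem_sym k (\<lambda>i. (l $ i)\<^sup>2)) *
      (\<Prod>j\<in>UNIV. F w j (x $ j)))"
    unfolding m_def elem_sym_scale
    by (intro sum.cong refl) (simp add: W_def elem_sym_permute[of _ k "\<lambda>i. (l $ i)\<^sup>2"])
  finally show ?thesis1
    by (simp add: g_eq sum_distrib_left mult_ac)
  \<comment> \<open>The Laplacian is computed directly from the second derivatives; the sum of the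
    eigenvalues over the coordinates is again invariant under \<open>w\<close>.\<close>
  have "laplacian g x = (\<Sum>w\<in>W. c w * (\<Sum>i\<in>UNIV. m w i) * (\<Prod>j\<in>UNIV. F w j (x $ j)))"
    unfolding laplacian_def g_eq partial_deriv2_sum_prod[where F = F and F' = F' and m = m, OF F F']
    by (subst sum.swap) (simp add: sum_distrib_left sum_distrib_right)
  also have "\<dots> = (\<Sum>w\<in>W. c w * (- 4 * pi\<^sup>2 * (l \<bullet> l)) * (\<Prod>j\<in>UNIV. F w j (x $ j)))"
  proof (intro sum.cong refl)
    fix w assume "w \<in> W"
    then have "(\<Sum>i\<in>UNIV. (l $ w i)\<^sup>2) = (\<Sum>i\<in>UNIV. (l $ i)\<^sup>2)"
      using sum.permute[of w UNIV "\<lambda>i. (l $ i)\<^sup>2"] by (simp add: W_def o_def)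
    then have "(\<Sum>i\<in>UNIV. m w i) = - 4 * pi\<^sup>2 * (l \<bullet> l)"
      unfolding m_def sum_distrib_left[symmetric] by (simp add: inner_vec_def power2_eq_square)
    then show "c w * (\<Sum>i\<in>UNIV. m w i) * (\<Prod>j\<in>UNIV. F w j (x $ j)) =
        c w * (- 4 * pi\<^sup>2 * (l \<bullet> l)) * (\<Prod>j\<in>UNIV. F w j (x $ j))"
      by simp
  qed
  finally show ?thesis2
    by (simp add: g_eq sum_distrib_left mult_ac)
qed

text \<open>
  The determinant in the library permutes the column index, but the derivatives act on columns,
  so the permutation is moved to the rows by transposition.
\<close>

lemma det_row_permutations:
  fixes A :: "'a::comm_ring_1 ^ 'n ^ 'n"
  shows "det A = (\<Sum>w | w permutes UNIV. of_int (sign w) * (\<Prod>j\<in>UNIV. A $ w j $ j))"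
  by (subst det_transpose[symmetric]) (simp add: det_def transpose_def)

theorem mainTheorem5:
  fixes l :: "real ^ 'n::{finite,linorder}" and g :: "real ^ 'n::{finite,linorder} \<Rightarrow> real"
  assumes "g \<in> {sin_minus l, sin_plus l, cos_minus l, cos_plus l}"
  shows "(\<forall>k\<in>{1..CARD('n)}. \<forall>x.
            elem_sym_op k partial_deriv2 g x =
              (- 4 * pi\<^sup>2) ^ k * elem_sym k (\<lambda>i. (l $ i)\<^sup>2) * g x) \<and>
         (\<forall>x. laplacian g x = - 4 * pi\<^sup>2 * (l \<bullet> l) * g x)"
proof -
  have sin': "(sin has_real_derivative cos t) (at t)"
    and cos': "(cos has_real_derivative - sin t) (at t)"
    and minus_sin': "((\<lambda>t. - sin t) has_real_derivative - cos t) (at t)" for t :: real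
    by (auto intro!: derivative_eq_intros)
  \<comment> \<open>The coefficients \<open>c\<close> stay free: the sign of \<open>w\<close> gives
    the determinants, the constant 1 the unsigned sums.\<close>
  note sin_sum = elem_sym_op_trig_sum[where h = sin and h' = cos and l = l and g = g, OF sin' cos']
  note cos_sum = elem_sym_op_trig_sum[where h = cos and h' = "\<lambda>t. - sin t" and l = l and g = g,
      OF cos' minus_sin']
  from assms consider "g = sin_minus l" | "g = sin_plus l" | "g = cos_minus l" | "g = cos_plus l"
    by blast
  then show ?thesis
  proof cases
    case 1
    then show ?thesis
      using sin_sum[of "\<lambda>w. of_int (sign w)"]
      by (simp add: sin_minus_def det_row_permutations)
  next
    case 2
    then show ?thesis
      using sin_sum[of "\<lambda>w. 1"] by (simp add: sin_plus_def)
  next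
    case 3
    then show ?thesis
      using cos_sum[of "\<lambda>w. of_int (sign w)"]
      by (simp add: cos_minus_def det_row_permutations)
  next
    case 4
    then show ?thesis
      using cos_sum[of "\<lambda>w. 1"] by (simp add: cos_plus_def)
  qed
qed

end
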